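(* Let $p$ and $q$ be distinct primes such that $q+1 \mid p-1$, and consider the equation $$\frac{1}{a}+\frac{1}{b}=\frac{q+1}{pq}$$ in (nonzero) integers $a,b$. The pairs $(a,b)=(p,pq)$ and $(a,b)=(pq,p)$ are solutions (the two trivial solutions). The remaining integer solutions, i.e. the integer solutions other than these two, are exactly the pairs $(a,b)$ given by $$a=\frac{\zeta p^2+pq}{q+1},\qquad b=\frac{\zeta pq+q^2}{\zeta(q+1)}$$ and the pairs $(a,b)$ given by $$a=\frac{\zeta pq+q^2}{\zeta(q+1)},\qquad b=\frac{\zeta p^2+pq}{q+1},$$ where $\zeta$ ranges over the integers satisfying $\zeta\equiv 1 \pmod{q+1}$ and $\zeta\mid q^2$.
   Context: Here $x \mid y$ denotes divisibility in $\mathbb{Z}$. The integer $\zeta$ may be positive or negative. *)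

theory Defs
  imports Complex_Main "HOL-Number_Theory.Cong" "HOL-Computational_Algebra.Primes"
begin

text \<open>The equation is read in the rationals, so integrality of \<open>a\<close> and \<open>b\<close> is carried by their type;
  they must be required to be nonzero explicitly because \<open>1 / 0 = 0\<close>.\<close>

definition solutions :: "int \<Rightarrow> int \<Rightarrow> (int \<times> int) set" where
  "solutions p q = {(a, b). a \<noteq> 0 \<and> b \<noteq> 0 \<and>
     1 / rat_of_int a + 1 / rat_of_int b = rat_of_int (q + 1) / rat_of_int (p * q)}"

definition params :: "int \<Rightarrow> int set" where
  "params q = {\<zeta>. [\<zeta> = 1] (mod (q + 1)) \<and> \<zeta> dvd q\<^sup>2}"

text \<open>The two expressions of the parametrisation are exact rational quotients, not integer divisions,
  so that their integrality is part of any claim that they yield integer solutions.\<close>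

definition expr1 :: "int \<Rightarrow> int \<Rightarrow> int \<Rightarrow> rat" where
  "expr1 p q \<zeta> = rat_of_int (\<zeta> * p\<^sup>2 + p * q) / rat_of_int (q + 1)"

definition expr2 :: "int \<Rightarrow> int \<Rightarrow> int \<Rightarrow> rat" where
  "expr2 p q \<zeta> = rat_of_int (\<zeta> * p * q + q\<^sup>2) / rat_of_int (\<zeta> * (q + 1))"

end

theory Submission
  imports Defs
begin

text \<open>
  Put \<open>n = q + 1\<close>. Clearing denominators and completing the product turns the equation into
  \<open>X * Y = p\<^sup>2 * q\<^sup>2\<close> with \<open>X = n * a - p * q\<close> and \<open>Y = n * b - p * q\<close>
  (\<open>solutions_iff_product\<close>). As \<open>p \<equiv> 1\<close> and \<open>q \<equiv> -1\<close> modulo \<open>n\<close>, integrality of \<open>a\<close> and \<open>b\<close> says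
  exactly that \<open>X \<equiv> Y \<equiv> 1\<close> modulo \<open>n\<close>.

  The two factors \<open>p\<close> on the right-hand side can be distributed in three ways.
  If both go to \<open>X\<close>, then \<open>X = \<zeta> * p\<^sup>2\<close> and \<open>Y = q\<^sup>2 / \<zeta>\<close> with \<open>\<zeta> \<equiv> 1\<close>, which is the first family
  (\<open>p_squared_dvd_imp_parametrised\<close>); if both go to \<open>Y\<close>, the result is the second family.
  If each of \<open>X\<close> and \<open>Y\<close> receives one, then \<open>X = p * \<xi>\<close> with \<open>\<xi> dvd q\<^sup>2\<close> and \<open>\<xi> \<equiv> 1\<close>,
  which leaves only \<open>\<xi> = 1\<close>, \<open>\<xi> = q\<^sup>2\<close> and \<open>\<xi> = -q\<close>
  (\<open>dvd_prime_square_cong_1_cases\<close>): the two trivial solutions, and the forbidden \<open>a = 0\<close>.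
  Conversely every parameter gives a solution, and it is neither degenerate nor trivial because
  \<open>p\<close> does not divide \<open>q\<close> (\<open>parametrised_imp_nontrivial_solution\<close>).
\<close>

lemma solutions_iff_product:
  assumes "p \<noteq> 0" "q \<noteq> 0" "q + 1 \<noteq> 0"
  shows "(a, b) \<in> solutions p q \<longleftrightarrow> a \<noteq> 0 \<and> b \<noteq> 0 \<and>
    ((q + 1) * a - p * q) * ((q + 1) * b - p * q) = p\<^sup>2 * q\<^sup>2"
proof (cases "a = 0 \<or> b = 0")
  case False
  have "1 / rat_of_int a + 1 / rat_of_int b = rat_of_int (a + b) / rat_of_int (a * b)"
    using False by (simp add: field_simps)
  hence "1 / rat_of_int a + 1 / rat_of_int b = rat_of_int (q + 1) / rat_of_int (p * q) \<longleftrightarrow>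
      rat_of_int ((a + b) * (p * q)) = rat_of_int ((q + 1) * (a * b))"
    using False assms(1,2) by (simp add: frac_eq_eq)
  also have "\<dots> \<longleftrightarrow> (a + b) * (p * q) = (q + 1) * (a * b)"
    unfolding of_int_eq_iff ..
  also have "\<dots> \<longleftrightarrow> (q + 1) * ((q + 1) * (a * b) - (a + b) * (p * q)) = 0"
    using assms(3) by auto
  also have "(q + 1) * ((q + 1) * (a * b) - (a + b) * (p * q)) =
      ((q + 1) * a - p * q) * ((q + 1) * b - p * q) - p\<^sup>2 * q\<^sup>2"
    by (simp add: power2_eq_square algebra_simps)
  finally show ?thesis
    using False by (simp add: solutions_def)
qed (auto simp: solutions_def)

lemma solutions_swap: "(b, a) \<in> solutions p q \<longleftrightarrow> (a, b) \<in> solutions p q"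
  by (auto simp: solutions_def add.commute)

text \<open>Modulo \<open>q + 1\<close> the divisors \<open>1, q, q\<^sup>2\<close> are congruent to \<open>1, -1, 1\<close>, so each of them
  is admissible with exactly one sign; the signs are distinguishable because \<open>q + 1 > 2\<close>.\<close>

lemma dvd_prime_square_cong_1_cases:
  fixes q \<xi> :: int
  assumes "prime q" "\<xi> dvd q\<^sup>2" "q + 1 dvd \<xi> - 1"
  shows "\<xi> = 1 \<or> \<xi> = - q \<or> \<xi> = q\<^sup>2"
proof -
  have q: "q > 1" using assms(1) by (simp add: prime_gt_1_int)
  obtain i where i: "i \<le> 2" "normalize \<xi> = q ^ i"
    using divides_primepow[OF assms(1,2)] .
  have not_dvd_2: "\<not> q + 1 dvd 2"
    using zdvd_imp_le[of "q + 1" 2] q by auto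
  have "\<bar>\<xi>\<bar> = q ^ i" using i(2) by simp
  hence "\<xi> = q ^ i \<or> \<xi> = - (q ^ i)" by linarith
  moreover have "i = 0 \<or> i = 1 \<or> i = 2" using i(1) by auto
  ultimately have "\<xi> \<in> {1, -1, q, - q, q\<^sup>2, - q\<^sup>2}" by auto
  moreover have "\<xi> \<noteq> -1" using assms(3) not_dvd_2 by auto
  moreover have "\<xi> \<noteq> q"
    using assms(3) not_dvd_2 dvd_diff[of "q + 1" "q + 1" "q - 1"] by auto
  moreover have "\<xi> \<noteq> - q\<^sup>2"
  proof
    assume "\<xi> = - q\<^sup>2"
    hence "(q + 1) * (q - 1) + (\<xi> - 1) = - 2" by (simp add: power2_eq_square algebra_simps)
    hence "q + 1 dvd - 2" using assms(3) by (metis dvd_add dvd_triv_left)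
    thus False using not_dvd_2 by simp
  qed
  ultimately show ?thesis by auto
qed

text \<open>With \<open>c = q\<^sup>2 / \<zeta>\<close> the second expression becomes \<open>(c + p * q) / (q + 1)\<close>, so that both
  expressions can be handled as exact integer identities.\<close>

lemma of_int_eq_exprs:
  assumes "q + 1 \<noteq> 0" "\<zeta> \<noteq> 0" "\<zeta> * c = q\<^sup>2"
  shows "rat_of_int a = expr1 p q \<zeta> \<longleftrightarrow> (q + 1) * a = \<zeta> * p\<^sup>2 + p * q"
    and "rat_of_int b = expr2 p q \<zeta> \<longleftrightarrow> (q + 1) * b = c + p * q"
proof -
  have n: "rat_of_int (q + 1) \<noteq> 0" using assms(1) by (simp only: of_int_eq_0_iff not_False_eq_True)
  have "rat_of_int a = expr1 p q \<zeta> \<longleftrightarrow>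
      rat_of_int ((q + 1) * a) = rat_of_int (\<zeta> * p\<^sup>2 + p * q)"
    unfolding expr1_def of_int_mult[of "q + 1"]
    by (subst eq_divide_eq) (use n in \<open>auto simp: mult.commute\<close>)
  thus "rat_of_int a = expr1 p q \<zeta> \<longleftrightarrow> (q + 1) * a = \<zeta> * p\<^sup>2 + p * q"
    unfolding of_int_eq_iff .
  have "rat_of_int b = expr2 p q \<zeta> \<longleftrightarrow>
      rat_of_int (\<zeta> * ((q + 1) * b)) = rat_of_int (\<zeta> * p * q + q\<^sup>2)"
    unfolding expr2_def of_int_mult[of \<zeta> "q + 1"] of_int_mult[of \<zeta> "(q + 1) * b"]
      of_int_mult[of "q + 1" b]
    by (subst eq_divide_eq) (use n assms(2) in \<open>auto simp: mult_ac\<close>)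
  also have "\<dots> \<longleftrightarrow> \<zeta> * ((q + 1) * b) = \<zeta> * (c + p * q)"
    unfolding of_int_eq_iff assms(3)[symmetric] by (simp add: algebra_simps)
  finally show "rat_of_int b = expr2 p q \<zeta> \<longleftrightarrow> (q + 1) * b = c + p * q"
    using assms(2) by simp
qed

lemma p_squared_dvd_imp_parametrised:
  assumes "prime p" "prime q" "q + 1 dvd p - 1"
    and prod: "((q + 1) * a - p * q) * ((q + 1) * b - p * q) = p\<^sup>2 * q\<^sup>2"
    and dvd: "p\<^sup>2 dvd (q + 1) * a - p * q"
  shows "\<exists>\<zeta> \<in> params q. rat_of_int a = expr1 p q \<zeta> \<and> rat_of_int b = expr2 p q \<zeta>"
proof -
  have pos: "p > 0" "q > 0" using assms(1,2) by (auto simp: prime_gt_0_int)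
  obtain \<zeta> where \<zeta>: "(q + 1) * a - p * q = p\<^sup>2 * \<zeta>" using dvd by (elim dvdE)
  define c where "c = (q + 1) * b - p * q"
  have "p\<^sup>2 * (\<zeta> * c) = p\<^sup>2 * q\<^sup>2" using prod by (simp add: \<zeta> c_def mult.assoc)
  hence c: "\<zeta> * c = q\<^sup>2" using pos by simp
  hence "\<zeta> \<noteq> 0" using pos by auto
  \<comment> \<open>\<open>p\<^sup>2 * \<zeta> = (q + 1) * (a - p) + p\<close>, and both \<open>p\<close> and \<open>p\<^sup>2\<close> are congruent to \<open>1\<close>.\<close>
  have "\<zeta> - 1 = (q + 1) * (a - p) + (p - 1) * (1 - (p + 1) * \<zeta>)"
    using \<zeta> by (simp add: power2_eq_square algebra_simps)
  hence "q + 1 dvd \<zeta> - 1" using assms(3) by simp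
  moreover have "\<zeta> dvd q\<^sup>2" by (simp flip: c)
  ultimately have "\<zeta> \<in> params q" by (simp add: params_def cong_iff_dvd_diff)
  moreover have "rat_of_int a = expr1 p q \<zeta>" "rat_of_int b = expr2 p q \<zeta>"
    using of_int_eq_exprs[of q \<zeta> c] \<zeta> c pos \<open>\<zeta> \<noteq> 0\<close> by (auto simp: c_def algebra_simps)
  ultimately show ?thesis by blast
qed

text \<open>If \<open>p\<close> occurs in both factors of \<open>p\<^sup>2 * q\<^sup>2\<close>, it occurs exactly once in each; this is the
  distribution that yields only the trivial solutions.\<close>

lemma nontrivial_solution_p_squared_dvd:
  assumes "prime p" "prime q" "q + 1 dvd p - 1"
    and sol: "(a, b) \<in> solutions p q" and nontriv: "(a, b) \<notin> {(p, p * q), (p * q, p)}"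
  shows "p\<^sup>2 dvd (q + 1) * a - p * q \<or> p\<^sup>2 dvd (q + 1) * b - p * q"
proof -
  have pos: "p > 0" "q > 0" using assms(1,2) by (auto simp: prime_gt_0_int)
  define X Y where "X = (q + 1) * a - p * q" and "Y = (q + 1) * b - p * q"
  have nz: "a \<noteq> 0" and XY: "X * Y = p\<^sup>2 * q\<^sup>2"
    using sol pos by (auto simp: solutions_iff_product X_def Y_def)
  consider "\<not> p dvd X" | "\<not> p dvd Y" | "p dvd X" "p dvd Y" by blast
  hence "p\<^sup>2 dvd X \<or> p\<^sup>2 dvd Y"
  proof cases
    case 1
    hence "coprime (p\<^sup>2) X" using assms(1) by (simp add: prime_imp_coprime)
    thus ?thesis using XY by (metis coprime_dvd_mult_right_iff dvd_triv_left)
  next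
    case 2
    hence "coprime (p\<^sup>2) Y" using assms(1) by (simp add: prime_imp_coprime)
    thus ?thesis using XY by (metis coprime_dvd_mult_left_iff dvd_triv_left)
  next
    case 3
    then obtain \<xi> \<eta> where \<xi>: "X = p * \<xi>" and \<eta>: "Y = p * \<eta>" by (auto simp: dvd_def)
    have "p\<^sup>2 * (\<xi> * \<eta>) = p\<^sup>2 * q\<^sup>2" using XY by (simp add: \<xi> \<eta> power2_eq_square mult_ac)
    hence prod: "\<xi> * \<eta> = q\<^sup>2" using pos by simp
    have a: "(q + 1) * a = p * (\<xi> + q)" and b: "(q + 1) * b = p * (\<eta> + q)"
      using \<xi> \<eta> by (simp_all add: X_def Y_def algebra_simps)
    have "q + 1 dvd p * (\<xi> + q)" by (simp flip: a)
    hence "q + 1 dvd p * (\<xi> + q) - ((p - 1) * (\<xi> + q) + (q + 1))"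
      by (rule dvd_diff[OF _ dvd_add[OF dvd_mult2[OF assms(3)] dvd_refl]])
    hence "q + 1 dvd \<xi> - 1" by (simp add: algebra_simps)
    moreover have "\<xi> dvd q\<^sup>2" by (simp flip: prod)
    ultimately consider "\<xi> = 1" | "\<xi> = - q" | "\<xi> = q\<^sup>2"
      using dvd_prime_square_cong_1_cases assms(2) by blast
    thus ?thesis
    proof cases
      case 1
      hence "(q + 1) * a = (q + 1) * p" "(q + 1) * b = (q + 1) * (p * q)"
        using a b prod by (simp_all add: power2_eq_square algebra_simps)
      thus ?thesis using nontriv pos by simp
    next
      case 2
      thus ?thesis using a nz pos by simp
    next
      case 3
      hence "\<eta> = 1" using prod pos by simp
      hence "(q + 1) * a = (q + 1) * (p * q)" "(q + 1) * b = (q + 1) * p"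
        using a b 3 by (simp_all add: power2_eq_square algebra_simps)
      thus ?thesis using nontriv pos by simp
    qed
  qed
  thus ?thesis by (simp add: X_def Y_def)
qed

text \<open>If \<open>a\<close> or \<open>b\<close> vanished, or \<open>a\<close> were \<open>p\<close> or \<open>p * q\<close>, then \<open>p\<close> would divide \<open>1\<close>, \<open>q\<close> or \<open>q\<^sup>2\<close>.
  Excluding these two values of \<open>a\<close> keeps both \<open>(a, b)\<close> and \<open>(b, a)\<close> away from the trivial
  solutions, so that one statement serves both families.\<close>

lemma parametrised_imp_nontrivial_solution:
  assumes "prime p" "prime q" "p \<noteq> q" "q + 1 dvd p - 1" "\<zeta> \<in> params q"
  obtains a b where "(a, b) \<in> solutions p q" "a \<noteq> p" "a \<noteq> p * q"
    "rat_of_int a = expr1 p q \<zeta>" "rat_of_int b = expr2 p q \<zeta>"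
proof -
  have pos: "p > 0" "q > 0" using assms(1,2) by (auto simp: prime_gt_0_int)
  have not_dvd: "\<not> p dvd q" "\<not> p dvd q\<^sup>2" "\<not> p dvd 1"
    using assms(1-3) by (auto simp: prime_dvd_power_iff primes_dvd_imp_eq)
  obtain c where c: "\<zeta> * c = q\<^sup>2" using assms(5) unfolding params_def dvd_def mem_Collect_eq by metis
  have "\<zeta> \<noteq> 0" using c pos by auto
  have \<zeta>: "[\<zeta> = 1] (mod q + 1)" using assms(5) by (simp add: params_def)
  have p: "[p = 1] (mod q + 1)" using assms(4) by (simp add: cong_iff_dvd_diff)
  have q: "[q = - 1] (mod q + 1)" by (simp add: cong_iff_dvd_diff)
  \<comment> \<open>The cofactor of \<open>\<zeta>\<close> inherits the congruence because \<open>q\<^sup>2 \<equiv> 1\<close>.\<close>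
  have "[\<zeta> * c = 1 * c] (mod q + 1)" using \<zeta> cong_refl by (rule cong_mult)
  moreover have "[q * q = - 1 * - 1] (mod q + 1)" using q q by (rule cong_mult)
  ultimately have c1: "[c = 1] (mod q + 1)"
    using c by (simp add: power2_eq_square) (metis cong_sym cong_trans)
  have pq: "[p * q = 1 * - 1] (mod q + 1)" using p q by (rule cong_mult)
  have "[\<zeta> * (p * p) + p * q = 1 * (1 * 1) + 1 * - 1] (mod q + 1)"
    by (intro cong_add cong_mult \<zeta> p q)
  then obtain a where a: "(q + 1) * a = \<zeta> * p\<^sup>2 + p * q"
    unfolding power2_eq_square by (metis cong_0_iff dvdE minus_mult_right mult_1 right_minus)
  have "[c + p * q = 1 + 1 * - 1] (mod q + 1)" using c1 pq by (rule cong_add)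
  then obtain b where b: "(q + 1) * b = c + p * q"
    by (metis cong_0_iff dvdE mult_1 right_minus)
  have a': "(q + 1) * a = p * (\<zeta> * p + q)" using a by (simp add: power2_eq_square algebra_simps)
  have "a \<noteq> 0"
  proof
    assume "a = 0"
    hence "\<zeta> * p + q = 0" using a' pos by auto
    hence "q = p * - \<zeta>" by (simp add: algebra_simps)
    thus False using not_dvd by simp
  qed
  moreover have "b \<noteq> 0"
  proof
    assume "b = 0"
    hence "c = p * - q" using b by simp
    hence "q\<^sup>2 = p * (- q * \<zeta>)" using c by (simp add: mult_ac)
    thus False using not_dvd by (metis dvd_triv_left)
  qed
  moreover have "((q + 1) * a - p * q) * ((q + 1) * b - p * q) = p\<^sup>2 * q\<^sup>2"
    unfolding a b by (simp add: c[symmetric] mult_ac)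
  ultimately have "(a, b) \<in> solutions p q" using pos by (simp add: solutions_iff_product)
  moreover have "a \<noteq> p"
  proof
    assume "a = p"
    hence "p * (q + 1) = p * (\<zeta> * p + q)" using a' by (simp add: mult.commute)
    hence "q + 1 = \<zeta> * p + q" using pos by (simp only: mult_cancel_left) auto
    hence "1 = p * \<zeta>" by (simp add: mult.commute)
    thus False using not_dvd by (metis dvd_triv_left)
  qed
  moreover have "a \<noteq> p * q"
  proof
    assume "a = p * q"
    hence "p * ((q + 1) * q) = p * (\<zeta> * p + q)" using a' by (simp add: mult_ac)
    hence "(q + 1) * q = \<zeta> * p + q" using pos by (simp only: mult_cancel_left) auto
    hence "q\<^sup>2 = p * \<zeta>" by (simp add: power2_eq_square algebra_simps)
    thus False using not_dvd by (metis dvd_triv_left)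
  qed
  moreover have "rat_of_int a = expr1 p q \<zeta>" "rat_of_int b = expr2 p q \<zeta>"
    using of_int_eq_exprs[of q \<zeta> c] a b c pos \<open>\<zeta> \<noteq> 0\<close> by auto
  ultimately show ?thesis by (rule that)
qed

theorem theorem1:
  fixes p q :: int
  assumes "prime p" and "prime q" and "p \<noteq> q" and "q + 1 dvd p - 1"
  shows "(p, p * q) \<in> solutions p q \<and> (p * q, p) \<in> solutions p q \<and>
    map_prod rat_of_int rat_of_int ` (solutions p q - {(p, p * q), (p * q, p)}) =
      {(expr1 p q \<zeta>, expr2 p q \<zeta>) | \<zeta>. \<zeta> \<in> params q} \<union>
      {(expr2 p q \<zeta>, expr1 p q \<zeta>) | \<zeta>. \<zeta> \<in> params q}"
    (is "_ \<and> _ \<and> ?L = ?R")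
proof (intro conjI)
  have pos: "p > 0" "q > 0" using assms(1,2) by (auto simp: prime_gt_0_int)
  show "(p, p * q) \<in> solutions p q"
    using pos by (simp add: solutions_iff_product power2_eq_square algebra_simps)
  thus "(p * q, p) \<in> solutions p q" by (simp only: solutions_swap)
  show "?L = ?R"
  proof (intro equalityI subsetI)
    fix z assume "z \<in> ?L"
    then obtain a b where z: "z = (rat_of_int a, rat_of_int b)"
      and sol: "(a, b) \<in> solutions p q" and nontriv: "(a, b) \<notin> {(p, p * q), (p * q, p)}"
      by auto
    have prod: "((q + 1) * a - p * q) * ((q + 1) * b - p * q) = p\<^sup>2 * q\<^sup>2"
      using sol pos by (simp add: solutions_iff_product)
    from nontrivial_solution_p_squared_dvd[OF assms(1,2,4) sol nontriv] show "z \<in> ?R"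
    proof
      assume "p\<^sup>2 dvd (q + 1) * a - p * q"
      from p_squared_dvd_imp_parametrised[OF assms(1,2,4) prod this] show ?thesis
        using z by blast
    next
      assume "p\<^sup>2 dvd (q + 1) * b - p * q"
      from p_squared_dvd_imp_parametrised[OF assms(1,2,4) _ this] prod show ?thesis
        using z by (auto simp: mult.commute)
    qed
  next
    fix z assume "z \<in> ?R"
    then obtain \<zeta> where "\<zeta> \<in> params q"
      and z: "z = (expr1 p q \<zeta>, expr2 p q \<zeta>) \<or> z = (expr2 p q \<zeta>, expr1 p q \<zeta>)" by blast
    obtain a b where ab: "(a, b) \<in> solutions p q" "a \<noteq> p" "a \<noteq> p * q"
      "rat_of_int a = expr1 p q \<zeta>" "rat_of_int b = expr2 p q \<zeta>"
      using parametrised_imp_nontrivial_solution[OF assms \<open>\<zeta> \<in> params q\<close>] by blast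
    have "(a, b) \<in> solutions p q - {(p, p * q), (p * q, p)}"
      "(b, a) \<in> solutions p q - {(p, p * q), (p * q, p)}"
      using ab(1-3) by (auto simp: solutions_swap)
    moreover have "z = map_prod rat_of_int rat_of_int (a, b) \<or>
        z = map_prod rat_of_int rat_of_int (b, a)"
      using z ab(4,5) by simp
    ultimately show "z \<in> ?L" by blast
  qed
qed

end
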